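(* Let $G$ be a finite simple graph of even order, let $f:V(G)\rightarrow \mathbb{Z}^+$ be an even integer-valued function with $f(v)\geq 4$ for all $v\in V(G)$, and let $H_f(v)=\{1,3,\ldots,f(v)-1,f(v)\}$ for $v\in V(G)$. If $$o(G-S)\leq f(S)\qquad\text{for all } S\subseteq V(G),$$ then $G$ contains an $H_f$-factor.
   Context: For $S\subseteq V(G)$, $f(S)=\sum_{x\in S}f(x)$ (so $f(\emptyset)=0$), and $o(G-S)$ denotes the number of components of odd order of $G-S$. For a set function $H$ assigning to each vertex $v$ a set $H(v)$ of integers, an $H$-factor of $G$ is a spanning subgraph $F$ of $G$ with $d_F(v)\in H(v)$ for every $v\in V(G)$. *)

theory Defs
  imports "Graph_Theory.Graph_Theory"
begin

text \<open>
  A finite simple graph is an irreflexive symmetric finite digraph (\<^locale>\<open>pair_graph\<close>): each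
  undirected edge uv is the pair of arcs (u,v), (v,u). Hence the degree of a vertex is its
  \<^const>\<open>out_degree\<close>.
\<close>

definition delete_verts :: "('a, 'b) pre_digraph \<Rightarrow> 'a set \<Rightarrow> ('a, 'b) pre_digraph" where
  "delete_verts G S = G \<restriction> (verts G - S)"

text \<open>Maximal connected subgraphs; \<^const>\<open>connected\<close> excludes the graph without vertices.\<close>

definition components :: "('a, 'b) pre_digraph \<Rightarrow> ('a, 'b) pre_digraph set" where
  "components G = {C. pre_digraph.max_subgraph G connected C}"

definition num_odd_components :: "('a, 'b) pre_digraph \<Rightarrow> nat" where
  "num_odd_components G = card {C \<in> components G. odd (card (verts C))}"

text \<open>
  The conjunct \<^term>\<open>pair_graph F\<close> is needed because \<^const>\<open>spanning\<close> refers to subdigraphs,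
  which might contain only one of the two arcs of an edge.
\<close>

definition is_factor ::
  "('a \<Rightarrow> int set) \<Rightarrow> 'a pair_pre_digraph \<Rightarrow> 'a pair_pre_digraph \<Rightarrow> bool" where
  "is_factor H F G \<longleftrightarrow>
     pair_graph F \<and> spanning (with_proj F) (with_proj G) \<and>
     (\<forall>v \<in> pverts G. int (out_degree (with_proj F) v) \<in> H v)"

definition H_of :: "('a \<Rightarrow> int) \<Rightarrow> 'a \<Rightarrow> int set" where
  "H_of f v = {k. odd k \<and> 1 \<le> k \<and> k \<le> f v - 1} \<union> {f v}"

end

theory Submission
  imports Defs "HOL-Library.Disjoint_Sets"
begin

text \<open>
  Induction on the number of vertices and edges. Among the sets \<open>S\<close> that maximise the excess
  \<open>o(G - S) - (f(x) - 1 summed over x in S)\<close>, which is always even, take an inclusion-maximal one.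

  If \<open>S\<close> is nonempty, maximality and the hypothesis are exactly the two Hall conditions for
  assigning the odd components of \<open>G - S\<close> to adjacent vertices of \<open>S\<close> so that each \<open>s\<close> receives
  \<open>f(s) - 1\<close> or \<open>f(s)\<close> of them. An odd component together with one pendant edge to its assigned
  vertex, and the union of the even components, again satisfy the hypothesis, and the factors
  obtained by induction fit together: the pendant edges must be used, since degrees are positive.

  If \<open>S\<close> is empty, every nonempty set has excess at most \<open>-2\<close>. An edge whose deletion leaves all
  components even can be deleted, since it raises \<open>o(G - T)\<close> by at most 2; if there is no such edge,
  \<open>G\<close> is a forest with odd degrees less than \<open>f\<close>.
\<close>

section \<open>Odd components of an induced subgraph\<close>

text \<open>For symmetric \<open>E\<close> these are the unions of components of the subgraph
  induced on \<open>W\<close>. Taking components as the minimal nonempty ones replaces paths by set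
  algebra.\<close>

definition separated :: "'a rel \<Rightarrow> 'a set \<Rightarrow> 'a set \<Rightarrow> bool" where
  "separated E W A \<longleftrightarrow> A \<subseteq> W \<and> E `` A \<inter> W \<subseteq> A"

text \<open>The vertex sets of the components of the subgraph induced on \<open>W\<close>.\<close>

definition parts :: "'a rel \<Rightarrow> 'a set \<Rightarrow> 'a set set" where
  "parts E W = {C. C \<noteq> {} \<and> separated E W C \<and>
     (\<forall>B. B \<noteq> {} \<longrightarrow> separated E W B \<longrightarrow> B \<subseteq> C \<longrightarrow> B = C)}"

definition odd_parts :: "'a rel \<Rightarrow> 'a set \<Rightarrow> 'a set set" where
  "odd_parts E W = {C \<in> parts E W. odd (card C)}"

definition oc :: "'a rel \<Rightarrow> 'a set \<Rightarrow> nat" where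
  "oc E W = card (odd_parts E W)"

lemma separatedD: "separated E W A \<Longrightarrow> x \<in> A \<Longrightarrow> (x, y) \<in> E \<Longrightarrow> y \<in> W \<Longrightarrow> y \<in> A"
  by (auto simp: separated_def)

lemma separated_subset: "separated E W A \<Longrightarrow> A \<subseteq> W"
  by (auto simp: separated_def)

lemma separated_refl [simp]: "separated E W W"
  by (auto simp: separated_def)

lemma separated_Diff:
  assumes "sym E" "separated E W A" "separated E W B"
  shows "separated E W (A - B)"
  using assms unfolding separated_def sym_def by blast

lemma separated_Int:
  "separated E W A \<Longrightarrow> separated E W B \<Longrightarrow> separated E W (A \<inter> B)"
  unfolding separated_def by blast

lemma separated_Union:
  "(\<And>A. A \<in> P \<Longrightarrow> separated E W A) \<Longrightarrow> separated E W (\<Union>P)"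
  unfolding separated_def by blast

lemma parts_separated: "C \<in> parts E W \<Longrightarrow> separated E W C"
  by (auto simp: parts_def)

lemma parts_subset: "C \<in> parts E W \<Longrightarrow> C \<subseteq> W"
  by (auto simp: parts_def separated_def)

lemma finite_parts: "finite W \<Longrightarrow> finite (parts E W)"
  by (rule finite_subset[of _ "Pow W"]) (auto dest: parts_subset)

lemma finite_odd_parts: "finite W \<Longrightarrow> finite (odd_parts E W)"
  by (simp add: odd_parts_def finite_parts)

lemma ex_part:
  assumes "finite W" "separated E W A" "A \<noteq> {}"
  shows "\<exists>C \<in> parts E W. C \<subseteq> A"
proof -
  let ?M = "{B. B \<noteq> {} \<and> separated E W B}"
  have "finite ?M"
    by (rule finite_subset[of _ "Pow W"]) (auto simp: separated_def assms(1))
  from finite_has_minimal2[OF this, of A] assms(2,3)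
  obtain m where m: "m \<in> ?M" "m \<subseteq> A" "\<forall>b\<in>?M. b \<subseteq> m \<longrightarrow> m = b"
    by auto
  then have "m \<in> parts E W"
    unfolding parts_def by blast
  with m(2) show ?thesis by blast
qed

lemma disjoint_parts: "disjoint (parts E W)"
proof (rule disjointI)
  fix A B assume AB: "A \<in> parts E W" "B \<in> parts E W" "A \<noteq> B"
  have sep: "separated E W (A \<inter> B)"
    using AB by (intro separated_Int) (auto simp: parts_def)
  show "A \<inter> B = {}"
  proof (rule ccontr)
    assume "A \<inter> B \<noteq> {}"
    then have "A \<inter> B = A" "A \<inter> B = B"
      using AB sep unfolding parts_def by auto
    with AB(3) show False by simp
  qed
qed

lemma Union_parts_subset:
  assumes "sym E" "finite W" "separated E W A"
  shows "\<Union>{C \<in> parts E W. C \<subseteq> A} = A"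
proof (rule ccontr)
  let ?U = "\<Union>{C \<in> parts E W. C \<subseteq> A}"
  assume "?U \<noteq> A"
  then have "A - ?U \<noteq> {}" by auto
  moreover have "separated E W (A - ?U)"
    using assms by (intro separated_Diff separated_Union) (auto dest: parts_separated)
  ultimately obtain C where C: "C \<in> parts E W" "C \<subseteq> A - ?U"
    using ex_part[OF assms(2)] by blast
  then have "C \<subseteq> ?U" by auto
  with C show False by (auto simp: parts_def)
qed

text \<open>A separated set is the disjoint union of the parts inside it, so only the odd ones
  affect its parity.\<close>

lemma even_card_separated_iff:
  assumes "sym E" "finite W" "separated E W A"
  shows "even (card A) \<longleftrightarrow> even (card {C \<in> odd_parts E W. C \<subseteq> A})"
proof -
  let ?P = "{C \<in> parts E W. C \<subseteq> A}"
  have fin: "finite ?P" using finite_parts[OF assms(2)] by auto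
  have "finite C" if "C \<in> ?P" for C
    using that assms(2) by (auto dest: parts_subset intro: finite_subset)
  moreover have "pairwise disjnt ?P"
    using disjoint_parts[of E W] by (auto simp: disjoint_def pairwise_def disjnt_def)
  moreover have "card A = card (\<Union>?P)"
    using Union_parts_subset[OF assms] by simp
  ultimately have "card A = sum card ?P"
    by (simp only: card_Union_disjoint)
  then have "even (card A) \<longleftrightarrow> even (card {C \<in> ?P. odd (card C)})"
    using even_sum_iff[OF fin, of card] by simp
  also have "{C \<in> ?P. odd (card C)} = {C \<in> odd_parts E W. C \<subseteq> A}"
    by (auto simp: odd_parts_def)
  finally show ?thesis .
qed

lemma even_oc_iff:
  assumes "sym E" "finite W"
  shows "even (oc E W) \<longleftrightarrow> even (card W)"
proof -
  have "{C \<in> odd_parts E W. C \<subseteq> W} = odd_parts E W"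
    by (auto simp: odd_parts_def dest: parts_subset)
  then show ?thesis
    using even_card_separated_iff[OF assms separated_refl] by (simp add: oc_def)
qed

lemma ex_odd_part:
  assumes "sym E" "finite W" "separated E W A" "odd (card A)"
  shows "\<exists>C \<in> odd_parts E W. C \<subseteq> A"
proof -
  have "{C \<in> odd_parts E W. C \<subseteq> A} \<noteq> {}"
    using even_card_separated_iff[OF assms(1-3)] assms(4) by (metis card.empty even_zero)
  then show ?thesis by blast
qed

text \<open>The tool for comparing odd component counts under deletions: by parity each odd
  separated set contains an odd part, and disjointness makes the choice injective.\<close>

lemma card_le_oc:
  assumes "sym E" "finite W" "disjoint P"
    and "\<And>A. A \<in> P \<Longrightarrow> separated E W A" "\<And>A. A \<in> P \<Longrightarrow> odd (card A)"
  shows "card P \<le> oc E W"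
proof -
  have "\<forall>A\<in>P. \<exists>C. C \<in> odd_parts E W \<and> C \<subseteq> A"
    using ex_odd_part[OF assms(1,2)] assms(4,5) by blast
  then obtain h where h: "\<And>A. A \<in> P \<Longrightarrow> h A \<in> odd_parts E W \<and> h A \<subseteq> A"
    by metis
  have ne: "\<And>A. A \<in> P \<Longrightarrow> h A \<noteq> {}"
    using h by (fastforce simp: odd_parts_def)
  have "inj_on h P"
  proof (rule inj_onI, rule ccontr)
    fix A B assume AB: "A \<in> P" "B \<in> P" "h A = h B" "A \<noteq> B"
    then have "A \<inter> B = {}" using assms(3) by (simp add: disjoint_def)
    with h[OF AB(1)] h[OF AB(2)] AB(3) ne[OF AB(1)] show False by auto
  qed
  then show ?thesis
    unfolding oc_def using h finite_odd_parts[OF assms(2)]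
    by (intro card_inj_on_le[of h]) auto
qed

lemma disjoint_odd_parts: "disjoint (odd_parts E W)"
  using disjoint_parts[of E W] by (auto simp: odd_parts_def disjoint_def)

lemma odd_parts_disjoint:
  "A \<in> odd_parts E W \<Longrightarrow> B \<in> odd_parts E W \<Longrightarrow> x \<in> A \<Longrightarrow> x \<in> B \<Longrightarrow> A = B"
  using disjoint_odd_parts[of E W] by (auto simp: disjoint_def)

lemma odd_partsD:
  assumes "A \<in> odd_parts E W"
  shows "separated E W A" "odd (card A)" "A \<subseteq> W" "A \<noteq> {}"
  using assms by (auto simp: odd_parts_def parts_def separated_def)

lemma even_card_separated_if_oc_0:
  assumes "sym E" "finite W" "oc E W = 0" "separated E W A"
  shows "even (card A)"
  using ex_odd_part[OF assms(1,2,4)] assms(3) finite_odd_parts[OF assms(2), of E]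
  by (auto simp: oc_def)

section \<open>Assignments with prescribed multiplicities\<close>

text \<open>Distinctness matters because shifting along a path changes the assignment and must not
  disturb the points used by later arcs.\<close>

lemma distinct_path:
  assumes "(s, t) \<in> r\<^sup>*"
  shows "\<exists>p. p \<noteq> [] \<and> distinct p \<and> hd p = s \<and> last p = t \<and> successively (\<lambda>a b. (a, b) \<in> r) p"
  using assms
proof (induction rule: converse_rtrancl_induct)
  case base
  show ?case by (rule exI[of _ "[t]"]) simp
next
  case (step s u)
  then obtain p where p: "p \<noteq> []" "distinct p" "hd p = u" "last p = t"
    "successively (\<lambda>a b. (a, b) \<in> r) p" by blast
  show ?case
  proof (cases "s \<in> set p")
    case True
    then obtain xs ys where "p = xs @ s # ys" by (meson split_list)
    then show ?thesis using p
      by (intro exI[of _ "s # ys"]) (auto simp: successively_append_iff)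
  next
    case False
    then show ?thesis using p step(1)
      by (intro exI[of _ "s # p"]) (auto simp: successively_Cons)
  qed
qed

definition fibre :: "'x set \<Rightarrow> ('x \<Rightarrow> 's) \<Rightarrow> 's \<Rightarrow> 'x set" where
  "fibre X g s = {x \<in> X. g x = s}"

lemma card_fibre_upd:
  assumes "finite X" "x \<in> X" "g x \<noteq> t"
  shows "int (card (fibre X (g(x := t)) s)) =
    int (card (fibre X g s)) - of_bool (s = g x) + of_bool (s = t)"
proof -
  have fin: "finite (fibre X g s)" for s using assms(1) by (simp add: fibre_def)
  consider "s = g x" | "s = t" | "s \<noteq> g x" "s \<noteq> t" by blast
  then show ?thesis
  proof cases
    case 1
    then have "fibre X (g(x := t)) s = fibre X g s - {x}" "x \<in> fibre X g s"
      using assms by (auto simp: fibre_def)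
    moreover from this(2) have "card (fibre X g s) > 0" using fin card_gt_0_iff by blast
    ultimately show ?thesis using 1 assms fin by (simp add: of_nat_diff)
  next
    case 2
    then have "fibre X (g(x := t)) s = insert x (fibre X g s)" "x \<notin> fibre X g s"
      using assms by (auto simp: fibre_def)
    then show ?thesis using 2 assms fin by simp
  next
    case 3
    then have "fibre X (g(x := t)) s = fibre X g s" by (auto simp: fibre_def)
    then show ?thesis using 3 by simp
  qed
qed

definition valid :: "'x set \<Rightarrow> ('x \<Rightarrow> 's \<Rightarrow> bool) \<Rightarrow> ('x \<Rightarrow> 's) \<Rightarrow> bool" where
  "valid X R g \<longleftrightarrow> (\<forall>x\<in>X. R x (g x))"

text \<open>Its paths are the alternating paths of \<open>g\<close>: an arc from \<open>s\<close> to
  \<open>t\<close> means that some point now at \<open>s\<close> may move to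
  \<open>t\<close>.\<close>

definition shift :: "'x set \<Rightarrow> ('x \<Rightarrow> 's \<Rightarrow> bool) \<Rightarrow> ('x \<Rightarrow> 's) \<Rightarrow> 's rel" where
  "shift X R g = {(s, t). \<exists>x\<in>X. g x = s \<and> R x t}"

text \<open>Move one point per arc, starting at the head. Inner vertices lose one point and gain
  one, so only the two ends change; on a one-vertex path the corrections cancel.\<close>

lemma shift_along_path:
  assumes "finite X" "valid X R g" "p \<noteq> []" "distinct p"
    and "successively (\<lambda>a b. (a, b) \<in> shift X R g) p"
  shows "\<exists>g'. valid X R g' \<and> (\<forall>s. int (card (fibre X g' s)) =
    int (card (fibre X g s)) - of_bool (s = hd p) + of_bool (s = last p))"
  using assms(2-)
proof (induction p arbitrary: g)
  case (Cons a p)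
  show ?case
  proof (cases "p = []")
    case True
    then show ?thesis using Cons.prems by (intro exI[of _ g]) auto
  next
    case False
    then have "(a, hd p) \<in> shift X R g" and suc: "successively (\<lambda>a b. (a, b) \<in> shift X R g) p"
      using Cons.prems by (auto simp: successively_Cons)
    then obtain x where x: "x \<in> X" "g x = a" "R x (hd p)" by (auto simp: shift_def)
    let ?g = "g(x := hd p)"
    have "a \<noteq> hd p" using Cons.prems(3) False by auto
    note card = card_fibre_upd[OF assms(1) x(1), of g "hd p", unfolded x(2), OF this]
    have valid: "valid X R ?g" using Cons.prems(1) x by (auto simp: valid_def)
    \<comment> \<open>Only \<open>x\<close> has moved, and it left \<open>a\<close>. Later arcs
      start at vertices other than \<open>a\<close>, so their witnesses are unaffected.\<close>
    have suc': "successively (\<lambda>a b. (a, b) \<in> shift X R ?g) p"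
      using suc
    proof (rule successively_mono)
      fix b c assume "b \<in> set p" "c \<in> set p" "(b, c) \<in> shift X R g"
      moreover have "b \<noteq> a" using \<open>b \<in> set p\<close> Cons.prems(3) by auto
      ultimately show "(b, c) \<in> shift X R ?g"
        using x by (fastforce simp: shift_def)
    qed
    obtain g' where "valid X R g'" "\<forall>s. int (card (fibre X g' s)) =
      int (card (fibre X ?g s)) - of_bool (s = hd p) + of_bool (s = last p)"
      using Cons.IH[OF valid False _ suc'] Cons.prems(3) by (metis distinct.simps(2))
    then show ?thesis using card False by (intro exI[of _ g']) auto
  qed
qed simp

lemma shift_reachable:
  assumes "finite X" "valid X R g" "(s, t) \<in> (shift X R g)\<^sup>*"
  shows "\<exists>g'. valid X R g' \<and> (\<forall>y. int (card (fibre X g' y)) =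
    int (card (fibre X g y)) - of_bool (y = s) + of_bool (y = t))"
proof -
  obtain p where "p \<noteq> []" "distinct p" "hd p = s" "last p = t"
    "successively (\<lambda>a b. (a, b) \<in> shift X R g) p"
    using distinct_path[OF assms(3)] by blast
  with shift_along_path[OF assms(1,2)] show ?thesis by metis
qed

lemma sum_card_fibre:
  assumes "finite X" "finite Y"
  shows "card {x \<in> X. g x \<in> Y} = (\<Sum>s\<in>Y. card (fibre X g s))"
proof -
  have "{x \<in> X. g x \<in> Y} = (\<Union>s\<in>Y. fibre X g s)" by (auto simp: fibre_def)
  also have "card \<dots> = (\<Sum>s\<in>Y. card (fibre X g s))"
    using assms by (intro card_UN_disjoint) (auto simp: fibre_def)
  finally show ?thesis .
qed

text \<open>
  A Hall type theorem. An assignment minimising the total violation of the bounds has none: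
  otherwise the points reachable by alternating paths from an overfull point, or those from which
  a deficient point is reachable, violate one of the two conditions.
\<close>

lemma ex_bounded_assignment:
  fixes X :: "'x set" and S :: "'s set" and l u :: "'s \<Rightarrow> nat" and R :: "'x \<Rightarrow> 's \<Rightarrow> bool"
  assumes fin: "finite X" "finite S"
    and R: "\<And>x s. x \<in> X \<Longrightarrow> R x s \<Longrightarrow> s \<in> S"
    and lu: "\<And>s. s \<in> S \<Longrightarrow> l s \<le> u s"
    and lower: "\<And>Y. Y \<subseteq> S \<Longrightarrow> sum l Y \<le> card {x \<in> X. \<exists>s\<in>Y. R x s}"
    and upper: "\<And>Z. Z \<subseteq> X \<Longrightarrow> card Z \<le> sum u {s \<in> S. \<exists>x\<in>Z. R x s}"
  shows "\<exists>g. valid X R g \<and> (\<forall>s\<in>S. l s \<le> card (fibre X g s) \<and> card (fibre X g s) \<le> u s)"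
proof -
  define c where "c g s = card (fibre X g s)" for g :: "'x \<Rightarrow> 's" and s
  \<comment> \<open>With truncated subtraction this is the overload above \<open>u s\<close> plus
    the shortfall below \<open>l s\<close>.\<close>
  define d where "d g s = (c g s - u s) + (l s - c g s)" for g s
  define D where "D g = sum (d g) S" for g
  have "\<exists>s. R x s" if "x \<in> X" for x
  proof (rule ccontr)
    assume "\<not> ?thesis"
    then show False using upper[of "{x}"] that by simp
  qed
  then obtain g0 where "valid X R g0" unfolding valid_def by metis
  then obtain g where g: "valid X R g" and min: "\<And>g'. valid X R g' \<Longrightarrow> D g \<le> D g'"
    using ex_has_least_nat[of "valid X R" g0 D] by auto
  have gS: "g x \<in> S" if "x \<in> X" for x using g R that by (auto simp: valid_def)
  \<comment> \<open>Moving one unit from \<open>s\<close> to \<open>t\<close> creates no violation: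
    \<open>s\<close> stays at or above its lower bound, \<open>t\<close> at or below its upper one.
    The third part of \<open>slack\<close> makes one violation drop, against minimality.\<close>
  have no_improvement: False
    if path: "(s, t) \<in> (shift X R g)\<^sup>*" and st: "s \<in> S" "t \<in> S" "s \<noteq> t"
      and slack: "c g s > l s" "c g t < u t" "c g s > u s \<or> c g t < l t" for s t
  proof -
    obtain g' where g': "valid X R g'"
      "\<And>y. int (c g' y) = int (c g y) - of_bool (y = s) + of_bool (y = t)"
      using shift_reachable[OF fin(1) g path] unfolding c_def by blast
    have cs: "int (c g' s) = int (c g s) - 1" and ct: "int (c g' t) = int (c g t) + 1"
      using g'(2)[of s] g'(2)[of t] st(3) by auto
    have le: "d g' y \<le> d g y" if "y \<in> S" for y
    proof -
      consider "y = s" | "y = t" | "y \<noteq> s" "y \<noteq> t" by blast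
      then show ?thesis
      proof cases
        case 1 then show ?thesis using cs \<open>c g s > l s\<close> unfolding d_def 1 by linarith
      next
        case 2 then show ?thesis using ct \<open>c g t < u t\<close> unfolding d_def 2 by linarith
      next
        case 3 then show ?thesis using g'(2)[of y] unfolding d_def by simp
      qed
    qed
    have "d g' s < d g s \<or> d g' t < d g t"
      using slack cs ct lu[OF st(1)] lu[OF st(2)] unfolding d_def by linarith
    then have "D g' < D g"
      unfolding D_def using le st fin(2) by (intro sum_strict_mono_ex1) auto
    then show False using min[OF g'(1)] by simp
  qed
  have "c g s \<le> u s" if s: "s \<in> S" for s
  proof (rule ccontr)
    assume "\<not> c g s \<le> u s"
    then have s': "c g s > u s" by simp
    define Y where "Y = {t \<in> S. (s, t) \<in> (shift X R g)\<^sup>*}"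
    define Z where "Z = {x \<in> X. g x \<in> Y}"
    have Y: "Y \<subseteq> S" "finite Y" "s \<in> Y" using fin s by (auto simp: Y_def)
    have ge: "u t \<le> c g t" if "t \<in> Y" for t
      using no_improvement[of s t] s' s that lu[OF s] unfolding Y_def by fastforce
    \<comment> \<open>\<open>Y\<close> is closed under \<open>shift\<close>, so points placed in
      \<open>Y\<close> have no target outside it. They fill each \<open>t\<close> in
      \<open>Y\<close> up to \<open>u t\<close> and overfill \<open>s\<close>, contradicting
      \<open>upper\<close>.\<close>
    have N: "{t \<in> S. \<exists>x\<in>Z. R x t} \<subseteq> Y"
    proof safe
      fix x t assume "x \<in> Z" "R x t" "t \<in> S"
      then have "(s, g x) \<in> (shift X R g)\<^sup>*" "(g x, t) \<in> shift X R g"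
        by (auto simp: Z_def Y_def shift_def)
      then show "t \<in> Y" using \<open>t \<in> S\<close> by (auto simp: Y_def)
    qed
    have "card Z \<le> sum u {t \<in> S. \<exists>x\<in>Z. R x t}"
      by (rule upper) (auto simp: Z_def)
    also have "\<dots> \<le> sum u Y"
      using N Y by (intro sum_mono2) auto
    also have "\<dots> < (\<Sum>t\<in>Y. c g t)"
      using ge s' Y by (intro sum_strict_mono_ex1) auto
    also have "\<dots> = card Z"
      unfolding Z_def c_def by (rule sum_card_fibre[symmetric]) (use fin Y in auto)
    finally show False by simp
  qed
  moreover have "l s \<le> c g s" if s: "s \<in> S" for s
  proof (rule ccontr)
    assume "\<not> l s \<le> c g s"
    then have s': "c g s < l s" by simp
    define Y where "Y = {t \<in> S. (t, s) \<in> (shift X R g)\<^sup>*}"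
    have Y: "Y \<subseteq> S" "finite Y" "s \<in> Y" using fin s by (auto simp: Y_def)
    have le: "c g t \<le> l t" if "t \<in> Y" for t
      using no_improvement[of t s] s' s that lu[OF s] unfolding Y_def by fastforce
    \<comment> \<open>Dually, every point that may go to \<open>Y\<close> already sits in
      \<open>Y\<close>, although \<open>Y\<close> is filled to at most \<open>l\<close>, and to less
      at \<open>s\<close>.\<close>
    have "{x \<in> X. \<exists>t\<in>Y. R x t} \<subseteq> {x \<in> X. g x \<in> Y}"
    proof safe
      fix x t assume "x \<in> X" "R x t" "t \<in> Y"
      then have "(t, s) \<in> (shift X R g)\<^sup>*" "(g x, t) \<in> shift X R g"
        by (auto simp: Y_def shift_def)
      then show "g x \<in> Y" using gS[OF \<open>x \<in> X\<close>] unfolding Y_def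
        by (auto intro: converse_rtrancl_into_rtrancl)
    qed
    then have "card {x \<in> X. \<exists>t\<in>Y. R x t} \<le> card {x \<in> X. g x \<in> Y}"
      using fin by (intro card_mono) auto
    also have "\<dots> = (\<Sum>t\<in>Y. c g t)"
      unfolding c_def by (rule sum_card_fibre) (use fin Y in auto)
    also have "\<dots> < sum l Y"
      using le s' Y by (intro sum_strict_mono_ex1) auto
    finally show False using lower[OF Y(1)] by simp
  qed
  ultimately show ?thesis using g unfolding c_def by blast
qed

section \<open>Vertex and edge deletions\<close>

lemma separated_cong:
  assumes "\<And>x y. x \<in> W \<Longrightarrow> y \<in> W \<Longrightarrow> (x, y) \<in> E \<longleftrightarrow> (x, y) \<in> E'"
  shows "separated E W = separated E' W"
  using assms unfolding separated_def fun_eq_iff by blast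

lemma oc_cong:
  assumes "\<And>x y. x \<in> W \<Longrightarrow> y \<in> W \<Longrightarrow> (x, y) \<in> E \<longleftrightarrow> (x, y) \<in> E'"
  shows "oc E W = oc E' W"
  using separated_cong[of W E E'] assms by (simp add: oc_def odd_parts_def parts_def)

lemma card_odd_parts_containing: "finite W \<Longrightarrow> card {A \<in> odd_parts E W. x \<in> A} \<le> 1"
  using card_le_Suc0_iff_eq[of "{A \<in> odd_parts E W. x \<in> A}"] finite_odd_parts[of W E]
  by (auto dest: odd_parts_disjoint)

lemma disjoint_subset_odd_parts: "P \<subseteq> odd_parts E W \<Longrightarrow> disjoint P"
  using disjoint_odd_parts[of E W] by (auto simp: disjoint_def)

text \<open>At most two odd parts of the new graph contain an end of the edge; all others are
  separated in the old graph too.\<close>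

lemma oc_delete_edge:
  assumes "sym E" "finite W"
  shows "oc (E - {(u, v), (v, u)}) W \<le> oc E W + 2"
proof -
  let ?O = "odd_parts (E - {(u, v), (v, u)}) W"
  let ?P = "{A \<in> ?O. u \<notin> A \<and> v \<notin> A}"
  have "card ?O \<le> card (?P \<union> ({A \<in> ?O. u \<in> A} \<union> {A \<in> ?O. v \<in> A}))"
    using finite_odd_parts[OF assms(2)] by (intro card_mono) auto
  also have "\<dots> \<le> card ?P + card ({A \<in> ?O. u \<in> A} \<union> {A \<in> ?O. v \<in> A})"
    by (rule card_Un_le)
  also have "\<dots> \<le> card ?P + (card {A \<in> ?O. u \<in> A} + card {A \<in> ?O. v \<in> A})"
    by (intro add_left_mono card_Un_le)
  also have "\<dots> \<le> card ?P + 2"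
    using card_odd_parts_containing[OF assms(2), of "E - {(u, v), (v, u)}" u]
      card_odd_parts_containing[OF assms(2), of "E - {(u, v), (v, u)}" v] by linarith
  also have "card ?P \<le> oc E W"
  proof (rule card_le_oc[OF assms])
    show "disjoint ?P" by (rule disjoint_subset_odd_parts) blast
    fix A assume A: "A \<in> ?P"
    then have "separated (E - {(u, v), (v, u)}) W A" by (auto dest: odd_partsD)
    with A show "separated E W A" unfolding separated_def by blast
    show "odd (card A)" using A by (auto dest: odd_partsD)
  qed
  finally show ?thesis by (simp add: oc_def)
qed

text \<open>Used with \<open>s\<close> outside the component \<open>C\<close>: the only edge at
  \<open>s\<close> then goes to \<open>v\<close>, so a factor with positive degrees must contain
  it.\<close>

definition pendant :: "'a rel \<Rightarrow> 'a set \<Rightarrow> 'a \<Rightarrow> 'a \<Rightarrow> 'a rel" where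
  "pendant E C s v = E \<inter> C \<times> C \<union> {(s, v), (v, s)}"

lemma sym_pendant: "sym E \<Longrightarrow> sym (pendant E C s v)"
  unfolding pendant_def sym_def by blast

lemma oc_pendant:
  assumes "sym E" "finite C" "s \<notin> C" "T \<subseteq> C"
  shows "oc (pendant E C s v) (insert s C - T) \<le> oc E (C - T) + 1"
proof -
  let ?O = "odd_parts (pendant E C s v) (insert s C - T)"
  let ?P = "{A \<in> ?O. s \<notin> A}"
  have "card ?O \<le> card (?P \<union> {A \<in> ?O. s \<in> A})"
    using finite_odd_parts[of "insert s C - T" "pendant E C s v"] assms(2)
    by (intro card_mono) auto
  also have "\<dots> \<le> card ?P + card {A \<in> ?O. s \<in> A}"
    by (rule card_Un_le)
  also have "\<dots> \<le> card ?P + 1"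
    using card_odd_parts_containing[of "insert s C - T" "pendant E C s v" s] assms(2) by simp
  also have "card ?P \<le> oc E (C - T)"
  proof (rule card_le_oc)
    show "disjoint ?P" by (rule disjoint_subset_odd_parts) blast
    fix A assume A: "A \<in> ?P"
    then have "separated (pendant E C s v) (insert s C - T) A" by (auto dest: odd_partsD)
    with A show "separated E (C - T) A" unfolding separated_def pendant_def by blast
    show "odd (card A)" using A by (auto dest: odd_partsD)
  qed (use assms in auto)
  finally show ?thesis by (simp add: oc_def)
qed

text \<open>The pendant edge keeps \<open>s\<close> and \<open>v\<close> together and
  \<open>C\<close> is minimal, so the only nonempty separated set is \<open>insert s C\<close>,
  which has even size.\<close>

lemma oc_pendant_odd_part:
  assumes E: "sym E" "finite W" and C: "C \<in> odd_parts E W" and s: "s \<notin> W" and v: "v \<in> C"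
  shows "oc (pendant E C s v) (insert s C) = 0"
proof (rule ccontr)
  have fin: "finite C" using odd_partsD(3)[OF C] E(2) finite_subset by blast
  assume "\<not> ?thesis"
  then have "odd_parts (pendant E C s v) (insert s C) \<noteq> {}"
    by (auto simp: oc_def)
  then obtain A where A: "A \<in> odd_parts (pendant E C s v) (insert s C)" by blast
  note sep = odd_partsD(1)[OF A]
  have sv: "s \<in> A \<longleftrightarrow> v \<in> A"
    using separatedD[OF sep, of s v] separatedD[OF sep, of v s] v by (auto simp: pendant_def)
  have "separated E C (A \<inter> C)"
    using sep unfolding separated_def pendant_def by blast
  then have "separated E W (A \<inter> C)"
    using odd_partsD(1)[OF C] unfolding separated_def by blast
  then have "A \<inter> C = {} \<or> A \<inter> C = C"
    using C unfolding odd_parts_def parts_def by (metis (mono_tags, lifting) Int_lower2 mem_Collect_eq)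
  then have "A = {} \<or> A = insert s C"
    using sv v odd_partsD(3)[OF A] by blast
  moreover have "s \<notin> C" using s odd_partsD(3)[OF C] by blast
  ultimately have "even (card A)" using odd_partsD(2)[OF C] fin by auto
  with odd_partsD(2)[OF A] show False by simp
qed

text \<open>Removing \<open>T\<close> leaves the odd parts outside \<open>U\<close> intact; with the
  odd parts of \<open>U - T\<close> they form disjoint odd separated sets.\<close>

lemma oc_Diff_ge:
  assumes "sym E" "finite W" "separated E W U" "T \<subseteq> U"
  shows "oc E (U - T) + card {A \<in> odd_parts E W. A \<inter> U = {}} \<le> oc E (W - T)"
proof -
  let ?P = "odd_parts E (U - T)" and ?Q = "{A \<in> odd_parts E W. A \<inter> U = {}}"
  have UW: "U \<subseteq> W" using assms(3) by (rule separated_subset)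
  have fin: "finite ?P" "finite ?Q"
    using assms(2) UW finite_odd_parts[of "U - T" E] finite_odd_parts[of W E]
    by (auto intro: finite_subset)
  have "?P \<inter> ?Q = {}" using odd_partsD(3,4)[of _ E "U - T"] by blast
  then have "oc E (U - T) + card ?Q = card (?P \<union> ?Q)"
    using fin by (simp add: oc_def card_Un_disjoint)
  also have "\<dots> \<le> oc E (W - T)"
  proof (rule card_le_oc)
    show "disjoint (?P \<union> ?Q)"
    proof (rule disjoint_union)
      show "disjoint ?P" "disjoint ?Q"
        by (rule disjoint_subset_odd_parts, blast)+
      show "\<Union>?P \<inter> \<Union>?Q = {}" using odd_partsD(3)[of _ E "U - T"] by blast
    qed
    fix A assume A: "A \<in> ?P \<union> ?Q"
    show "odd (card A)" using A by (auto dest: odd_partsD)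
    show "separated E (W - T) A"
    proof (cases "A \<in> ?P")
      case True
      then show ?thesis using odd_partsD(1)[of A E "U - T"] assms(3)
        unfolding separated_def by blast
    next
      case False
      then have "separated E W A" "A \<inter> U = {}" using A by (auto dest: odd_partsD)
      then show ?thesis using assms(4) unfolding separated_def by blast
    qed
  qed (use assms in auto)
  finally show ?thesis .
qed

section \<open>Factors\<close>

definition admissible :: "('a \<Rightarrow> int) \<Rightarrow> 'a rel \<Rightarrow> 'a set \<Rightarrow> bool" where
  "admissible f E V \<longleftrightarrow> finite V \<and> sym E \<and> irrefl E \<and> E \<subseteq> V \<times> V \<and> even (card V) \<and>
     (\<forall>v\<in>V. even (f v) \<and> 4 \<le> f v) \<and> (\<forall>S\<subseteq>V. int (oc E (V - S)) \<le> sum f S)"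

definition has_factor :: "('a \<Rightarrow> int) \<Rightarrow> 'a rel \<Rightarrow> 'a set \<Rightarrow> bool" where
  "has_factor f E V \<longleftrightarrow> (\<exists>F\<subseteq>E. sym F \<and> (\<forall>v\<in>V. int (card (F `` {v})) \<in> H_of f v))"

text \<open>The deficiency for factors with odd degrees at most \<open>f x - 1\<close>. The
  hypothesis allows one more component per vertex of \<open>S\<close>, so the excess may be
  positive.\<close>

definition excess :: "('a \<Rightarrow> int) \<Rightarrow> 'a rel \<Rightarrow> 'a set \<Rightarrow> 'a set \<Rightarrow> int" where
  "excess f E V S = int (oc E (V - S)) - (\<Sum>x\<in>S. f x - 1)"

lemma admissibleD:
  assumes "admissible f E V"
  shows "finite V" "sym E" "irrefl E" "E \<subseteq> V \<times> V" "even (card V)"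
    "\<And>v. v \<in> V \<Longrightarrow> even (f v)" "\<And>v. v \<in> V \<Longrightarrow> 4 \<le> f v"
    "\<And>S. S \<subseteq> V \<Longrightarrow> int (oc E (V - S)) \<le> sum f S"
  using assms unfolding admissible_def by auto

lemma oc_admissible: "admissible f E V \<Longrightarrow> oc E V = 0"
  using admissibleD(8)[of f E V "{}"] by simp

text \<open>Both terms have the parity of \<open>card S\<close>: the sum because \<open>f\<close> is
  even, the component count because \<open>card V\<close> is even.\<close>

lemma even_excess:
  assumes adm: "admissible f E V" and S: "S \<subseteq> V"
  shows "even (excess f E V S)"
proof -
  note a = admissibleD[OF adm]
  have finS: "finite S" using S a(1) finite_subset by blast
  have "even (sum f S)" using a(6) S by (intro dvd_sum) auto
  then have "even (\<Sum>x\<in>S. f x - 1) \<longleftrightarrow> even (card S)"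
    by (simp add: sum_subtractf)
  moreover have "card V = card (V - S) + card S"
    using S a(1) finS by (simp add: card_Diff_subset card_mono)
  then have "even (card (V - S)) \<longleftrightarrow> even (card S)"
    using a(5) by simp
  then have "even (oc E (V - S)) \<longleftrightarrow> even (card S)"
    using even_oc_iff[OF a(2), of "V - S"] a(1) by simp
  ultimately show ?thesis unfolding excess_def by simp
qed

text \<open>
  If deleting any edge creates odd components, then for every vertex \<open>v\<close> the odd components of
  \<open>G - v\<close> correspond to the neighbours of \<open>v\<close>, and \<open>G\<close> itself is a factor.
\<close>

lemma has_factor_all_edges:
  assumes adm: "admissible f E V"
    and small: "\<And>v. v \<in> V \<Longrightarrow> int (oc E (V - {v})) \<le> f v - 1"
    and bridge: "\<And>u v. (u, v) \<in> E \<Longrightarrow> oc (E - {(u, v), (v, u)}) V \<noteq> 0"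
  shows "has_factor f E V"
proof -
  note a = admissibleD[OF adm]
  have even_sep: "even (card A)" if "separated E V A" for A
    using even_card_separated_if_oc_0[OF a(2,1) oc_admissible[OF adm] that] .
  have "int (card (E `` {v})) \<in> H_of f v" if v: "v \<in> V" for v
  proof -
    have D: "\<exists>D. D \<in> odd_parts E (V - {v}) \<and> D \<inter> E `` {v} = {u}" if u: "u \<in> E `` {v}" for u
    proof -
      define E' where "E' = E - {(u, v), (v, u)}"
      have uv: "(u, v) \<in> E" "(v, u) \<in> E" using u a(2) by (auto dest: symD)
      have "u \<noteq> v" using uv a(3) by (auto simp: irrefl_def)
      have sym': "sym E'" using a(2) by (auto simp: E'_def sym_def)
      have "odd_parts E' V \<noteq> {}"
        using bridge[OF uv(1)] by (auto simp: oc_def E'_def)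
      then obtain A0 where "A0 \<in> odd_parts E' V" by blast
      then have A0: "separated E' V A0" "odd (card A0)" by (auto dest: odd_partsD)
      \<comment> \<open>An odd set with \<open>u\<close> and \<open>v\<close> on the same side would
        be separated in \<open>E\<close> as well, where separated sets are even.\<close>
      have A0_uv: "u \<in> A0 \<longleftrightarrow> v \<notin> A0"
      proof (rule ccontr)
        assume "\<not> ?thesis"
        then have "separated E V A0" using A0(1) unfolding separated_def E'_def by blast
        then show False using even_sep A0(2) by blast
      qed
      have "\<exists>A. separated E' V A \<and> odd (card A) \<and> u \<in> A \<and> v \<notin> A"
      proof (cases "u \<in> A0")
        case True then show ?thesis using A0 A0_uv by blast
      next
        case False
        \<comment> \<open>Pass to the complement, which is odd because \<open>card V\<close> is
          even.\<close>
        have "A0 \<subseteq> V" using A0(1) by (rule separated_subset)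
        then have "card V = card (V - A0) + card A0"
          using a(1) by (simp add: card_Diff_subset card_mono finite_subset)
        then have "odd (card (V - A0))" using a(5) A0(2) by simp
        moreover have "separated E' V (V - A0)"
          by (intro separated_Diff sym' A0(1)) simp
        moreover have "u \<in> V" using uv a(4) by blast
        ultimately show ?thesis using False A0_uv by blast
      qed
      then obtain A where A: "separated E' V A" "odd (card A)" "u \<in> A" "v \<notin> A" by blast
      have "separated E (V - {v}) A"
        using A unfolding separated_def E'_def by blast
      then obtain D where D: "D \<in> odd_parts E (V - {v})" "D \<subseteq> A"
        using ex_odd_part[OF a(2), of "V - {v}" A] A(2) a(1) by auto
      have only_u: "w = u" if "w \<in> D" "(w, v) \<in> E" for w
        using that D(2) A separatedD[OF A(1), of w v] v by (auto simp: E'_def)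
      \<comment> \<open>Otherwise no vertex of \<open>D\<close> is adjacent to \<open>v\<close>, and
        \<open>D\<close> is an odd separated set of the whole graph.\<close>
      have "u \<in> D"
      proof (rule ccontr)
        assume "u \<notin> D"
        then have "separated E V D"
          using odd_partsD(1)[OF D(1)] only_u unfolding separated_def by blast
        then show False using even_sep odd_partsD(2)[OF D(1)] by blast
      qed
      moreover have "(w, v) \<in> E" if "w \<in> E `` {v}" for w
        using that a(2) by (auto dest: symD)
      ultimately have "D \<inter> E `` {v} = {u}"
        using only_u uv by blast
      then show ?thesis using D(1) by blast
    qed
    then obtain h where h: "\<And>u. u \<in> E `` {v} \<Longrightarrow> h u \<in> odd_parts E (V - {v}) \<and> h u \<inter> E `` {v} = {u}"
      by metis
    have "bij_betw h (E `` {v}) (odd_parts E (V - {v}))"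
      unfolding bij_betw_def
    proof
      show "inj_on h (E `` {v})"
        by (rule inj_onI) (use h in blast)
      show "h ` (E `` {v}) = odd_parts E (V - {v})"
      proof
        show "h ` (E `` {v}) \<subseteq> odd_parts E (V - {v})" using h by blast
        show "odd_parts E (V - {v}) \<subseteq> h ` (E `` {v})"
        proof
          fix D assume D: "D \<in> odd_parts E (V - {v})"
          have "D \<inter> E `` {v} \<noteq> {}"
          proof
            assume "D \<inter> E `` {v} = {}"
            then have "separated E V D"
              using odd_partsD(1)[OF D] a(2) unfolding separated_def sym_def by blast
            then show False using even_sep odd_partsD(2)[OF D] by blast
          qed
          then obtain u where u: "u \<in> D" "u \<in> E `` {v}" by blast
          then have "h u = D"
            using h[OF u(2)] D by (intro odd_parts_disjoint[of _ E "V - {v}" _ u]) auto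
          then show "D \<in> h ` (E `` {v})" using u by blast
        qed
      qed
    qed
    then have deg: "card (E `` {v}) = oc E (V - {v})"
      unfolding oc_def by (rule bij_betw_same_card)
    \<comment> \<open>By parity the degree of \<open>v\<close> is odd; with \<open>small\<close> it
      is one of the odd values in \<open>H_of f v\<close>.\<close>
    have "odd (card (V - {v}))" using v a(1,5) by (simp add: card_Diff_singleton card_gt_0_iff) 
        (metis One_nat_def Suc_pred card_gt_0_iff empty_iff even_Suc)
    then have "odd (oc E (V - {v}))"
      using even_oc_iff[OF a(2), of "V - {v}"] a(1) by simp
    then have "odd (int (oc E (V - {v})))" "1 \<le> int (oc E (V - {v}))"
      by (auto simp: Suc_le_eq odd_pos)
    then show ?thesis
      unfolding H_of_def deg using small[OF v] by simp
  qed
  then show ?thesis unfolding has_factor_def using a(2) by blast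
qed

section \<open>Inclusion-maximal sets of maximum excess\<close>

locale maximal_set =
  fixes f :: "'a \<Rightarrow> int" and E :: "'a rel" and V S :: "'a set"
  assumes adm: "admissible f E V"
    and S: "S \<subseteq> V"
    and excess_le: "\<And>T. T \<subseteq> V \<Longrightarrow> excess f E V T \<le> excess f E V S"
    and excess_less: "\<And>T. T \<subseteq> V \<Longrightarrow> S \<subset> T \<Longrightarrow> excess f E V T \<noteq> excess f E V S"
begin

lemmas adms = admissibleD[OF adm]

lemma fin: "finite S" "finite (V - S)"
  using S adms(1) finite_subset by auto

text \<open>Parity widens the strict inequality to a gap of 2, which later absorbs the odd
  components created by a pendant edge or an edge deletion.\<close>

lemma excess_superset:
  assumes "T \<subseteq> V" "S \<subset> T"
  shows "excess f E V T \<le> excess f E V S - 2"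
proof -
  have "excess f E V T < excess f E V S"
    using excess_le[of T] excess_less[of T] assms by fastforce
  moreover have "even (excess f E V T)" "even (excess f E V S)"
    using even_excess[OF adm] assms S by auto
  ultimately show ?thesis by presburger
qed

lemma excess_Un:
  assumes "T \<subseteq> V - S"
  shows "excess f E V (S \<union> T) = int (oc E (V - S - T)) - (\<Sum>x\<in>S. f x - 1) - (\<Sum>x\<in>T. f x - 1)"
proof -
  have "finite T" using assms fin(2) finite_subset by blast
  then have "(\<Sum>x\<in>S \<union> T. f x - 1) = (\<Sum>x\<in>S. f x - 1) + (\<Sum>x\<in>T. f x - 1)"
    using assms fin by (intro sum.union_disjoint) auto
  moreover have "V - (S \<union> T) = V - S - T" by blast
  ultimately show ?thesis by (simp add: excess_def)
qed

text \<open>The union of the even components of \<open>G - S\<close>, treated as one piece.\<close>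

definition rest :: "'a set" where
  "rest = V - S - \<Union>(odd_parts E (V - S))"

lemma rest_separated: "separated E (V - S) rest"
  unfolding rest_def
  by (rule separated_Diff[OF adms(2) separated_refl separated_Union]) (rule odd_partsD)

text \<open>Removing \<open>T\<close> from \<open>rest\<close> keeps all odd components of
  \<open>G - S\<close>, so the new odd components add to them; maximality of the excess at
  \<open>S\<close> bounds their number.\<close>

lemma admissible_rest: "admissible f (E \<inter> rest \<times> rest) rest"
proof -
  have sub: "rest \<subseteq> V - S" by (auto simp: rest_def)
  have "{C \<in> odd_parts E (V - S). C \<subseteq> rest} = {}"
    using odd_partsD(4)[of _ E "V - S"] unfolding rest_def by blast
  then have even: "even (card rest)"
    using even_card_separated_iff[OF adms(2) fin(2) rest_separated] by (metis card.empty even_zero)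
  have "int (oc (E \<inter> rest \<times> rest) (rest - T)) \<le> sum f T" if T: "T \<subseteq> rest" for T
  proof -
    have "{A \<in> odd_parts E (V - S). A \<inter> rest = {}} = odd_parts E (V - S)"
      unfolding rest_def by blast
    then have "oc E (rest - T) + oc E (V - S) \<le> oc E (V - S - T)"
      using oc_Diff_ge[OF adms(2) fin(2) rest_separated T] by (simp add: oc_def)
    moreover have "excess f E V (S \<union> T) \<le> excess f E V S"
      by (rule excess_le) (use S T sub in blast)
    ultimately have "int (oc E (rest - T)) \<le> (\<Sum>x\<in>T. f x - 1)"
      using excess_Un[of T] T sub unfolding excess_def by auto
    also have "\<dots> \<le> sum f T" by (rule sum_mono) simp
    also have "oc E (rest - T) = oc (E \<inter> rest \<times> rest) (rest - T)"
      by (rule oc_cong) auto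
    finally show ?thesis .
  qed
  then show ?thesis
    unfolding admissible_def
    using even adms sub fin by (auto simp: sym_def irrefl_def intro: finite_subset)
qed

text \<open>If \<open>s\<close> is in \<open>T\<close>, then \<open>f s\<close> absorbs the extra
  component; for empty \<open>T\<close> there is no odd part; otherwise the gap from
  \<open>excess_superset\<close> covers the one that \<open>s\<close> may add.\<close>

lemma admissible_pendant:
  assumes C: "C \<in> odd_parts E (V - S)" and s: "s \<in> S" and v: "v \<in> C"
  shows "admissible f (pendant E C s v) (insert s C)"
proof -
  note c = odd_partsD[OF C]
  have finC: "finite C" using c(3) fin(2) finite_subset by blast
  have sC: "s \<notin> C" using s c(3) by blast
  \<comment> \<open>All odd components except \<open>C\<close> survive the removal of
    \<open>T\<close>; the 1 accounts for the loss of \<open>C\<close>.\<close>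
  have est: "int (oc E (C - T)) + int (oc E (V - S)) \<le> int (oc E (V - S - T)) + 1"
    if "T \<subseteq> C" for T
  proof -
    have "{A \<in> odd_parts E (V - S). A \<inter> C = {}} = odd_parts E (V - S) - {C}"
      using C c(4) odd_parts_disjoint[OF C] by blast
    then have "card {A \<in> odd_parts E (V - S). A \<inter> C = {}} = oc E (V - S) - 1"
      using C by (simp add: oc_def)
    then show ?thesis
      using oc_Diff_ge[OF adms(2) fin(2) c(1) that] by linarith
  qed
  have nonempty: "int (oc E (C - T)) \<le> (\<Sum>x\<in>T. f x - 1) - 1" if T: "T \<subseteq> C" "T \<noteq> {}" for T
  proof -
    have "excess f E V (S \<union> T) \<le> excess f E V S - 2"
      by (rule excess_superset) (use S T c(3) in blast)+
    then show ?thesis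
      using est[OF T(1)] excess_Un[of T] T c(3) unfolding excess_def by auto
  qed
  have sum_le: "(\<Sum>x\<in>T. f x - 1) \<le> sum f T" for T
    by (rule sum_mono) simp
  have "int (oc (pendant E C s v) (insert s C - T)) \<le> sum f T" if T: "T \<subseteq> insert s C" for T
  proof (cases "s \<in> T")
    case True
    define T' where "T' = T - {s}"
    have T': "T' \<subseteq> C" "insert s C - T = C - T'" using T True sC by (auto simp: T'_def)
    have "finite T'" using T'(1) finC finite_subset by blast
    then have sum: "sum f T = f s + sum f T'"
      using True by (simp add: T'_def sum.remove)
    have "f s \<ge> 4" using s S adms(7) by blast
    have "int (oc E (C - T')) \<le> 1 + sum f T'"
      using est[OF T'(1)] nonempty[OF T'(1)] sum_le[of T'] by (cases "T' = {}") auto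
    moreover have "oc (pendant E C s v) (C - T') = oc E (C - T')"
      by (rule oc_cong) (use sC in \<open>auto simp: pendant_def\<close>)
    ultimately show ?thesis using sum T'(2) \<open>f s \<ge> 4\<close> by simp
  next
    case False
    then have TC: "T \<subseteq> C" using T by blast
    show ?thesis
    proof (cases "T = {}")
      case True
      then show ?thesis
        using oc_pendant_odd_part[OF adms(2) fin(2) C _ v, of s] s by simp
    next
      case False
      then show ?thesis
        using oc_pendant[OF adms(2) finC sC TC, of v] nonempty[OF TC] sum_le[of T] by linarith
    qed
  qed
  moreover have "even (card (insert s C))" using c(2) finC sC by simp
  moreover have "irrefl (pendant E C s v)"
    using adms(3) sC v by (auto simp: pendant_def irrefl_def)
  ultimately show ?thesis
    unfolding admissible_def
    using sym_pendant[OF adms(2)] finC adms(6,7) s S v c(3)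
    by (auto simp: pendant_def)
qed

text \<open>The lower Hall condition compares the excess of \<open>S\<close> with that of
  \<open>S - Y\<close>; the upper one is the hypothesis for the set of neighbours of
  \<open>Z\<close> in \<open>S\<close>.\<close>

lemma ex_assignment:
  "\<exists>g. (\<forall>C\<in>odd_parts E (V - S). \<exists>v\<in>C. g C \<in> S \<and> (v, g C) \<in> E) \<and>
     (\<forall>s\<in>S. int (card {C \<in> odd_parts E (V - S). g C = s}) \<in> {f s - 1, f s})"
proof -
  let ?X = "odd_parts E (V - S)"
  define R where "R C s \<longleftrightarrow> s \<in> S \<and> (\<exists>v\<in>C. (v, s) \<in> E)" for C s
  have f4: "4 \<le> f s" if "s \<in> S" for s using that S adms(7) by blast
  \<comment> \<open>All neighbours in \<open>S\<close> of a component in \<open>Z\<close> lie in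
    \<open>N\<close>, so it stays separated when the rest of \<open>S\<close> is put back.\<close>
  have card_le: "card Z \<le> oc E (V - N)"
    if Z: "Z \<subseteq> ?X" and N: "N \<subseteq> S" "\<And>C s. C \<in> Z \<Longrightarrow> R C s \<Longrightarrow> s \<in> N" for Z N
  proof (rule card_le_oc[OF adms(2)])
    show "disjoint Z" using Z by (rule disjoint_subset_odd_parts)
    fix C assume C: "C \<in> Z"
    then have "separated E (V - S) C" "C \<subseteq> V - S" using Z by (auto dest: odd_partsD)
    with N C show "separated E (V - N) C" unfolding separated_def R_def by blast
    show "odd (card C)" using C Z by (auto dest: odd_partsD)
  qed (simp add: adms(1))
  have "\<exists>g. valid ?X R g \<and> (\<forall>s\<in>S. nat (f s - 1) \<le> card (fibre ?X g s) \<and>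
      card (fibre ?X g s) \<le> nat (f s))"
  proof (rule ex_bounded_assignment)
    show "finite ?X" "finite S" using fin finite_odd_parts by auto
    show "s \<in> S" if "R C s" for C s using that by (simp add: R_def)
    show "nat (f s - 1) \<le> nat (f s)" for s by simp
    show "sum (\<lambda>s. nat (f s - 1)) Y \<le> card {C \<in> ?X. \<exists>s\<in>Y. R C s}" if Y: "Y \<subseteq> S" for Y
    proof -
      let ?N = "{C \<in> ?X. \<exists>s\<in>Y. R C s}"
      have "card (?X - ?N) \<le> oc E (V - (S - Y))"
        by (rule card_le) (auto simp: R_def)
      moreover have "card ?X = card (?X - ?N) + card ?N"
        using finite_odd_parts[OF fin(2)]
        by (metis (no_types, lifting) card_Diff_subset card_mono finite_subset
            le_add_diff_inverse2 mem_Collect_eq subsetI)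
      moreover have "excess f E V (S - Y) \<le> excess f E V S"
        by (rule excess_le) (use S in blast)
      moreover have "(\<Sum>x\<in>S. f x - 1) = (\<Sum>x\<in>S - Y. f x - 1) + (\<Sum>x\<in>Y. f x - 1)"
        using Y fin(1) by (rule sum.subset_diff)
      ultimately have "(\<Sum>x\<in>Y. f x - 1) \<le> int (card ?N)"
        unfolding excess_def by (simp add: oc_def)
      moreover have "int (sum (\<lambda>s. nat (f s - 1)) Y) = (\<Sum>x\<in>Y. f x - 1)"
        unfolding of_nat_sum using f4 Y by (intro sum.cong) fastforce+
      ultimately show ?thesis by linarith
    qed
    show "card Z \<le> sum (\<lambda>s. nat (f s)) {s \<in> S. \<exists>C\<in>Z. R C s}" if Z: "Z \<subseteq> ?X" for Z
    proof -
      let ?N = "{s \<in> S. \<exists>C\<in>Z. R C s}"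
      have "int (card Z) \<le> int (oc E (V - ?N))"
        using card_le[OF Z, of ?N] by (auto simp: R_def)
      also have "\<dots> \<le> sum f ?N"
        by (rule adms(8)) (use S in blast)
      also have "\<dots> = int (sum (\<lambda>s. nat (f s)) ?N)"
        unfolding of_nat_sum using f4 by (intro sum.cong) fastforce+
      finally show ?thesis by linarith
    qed
  qed
  then obtain g where g: "valid ?X R g"
    "\<And>s. s \<in> S \<Longrightarrow> nat (f s - 1) \<le> card (fibre ?X g s) \<and> card (fibre ?X g s) \<le> nat (f s)"
    by blast
  have "int (card (fibre ?X g s)) \<in> {f s - 1, f s}" if "s \<in> S" for s
    using g(2)[OF that] f4[OF that] by auto
  moreover have "\<forall>C\<in>?X. \<exists>v\<in>C. g C \<in> S \<and> (v, g C) \<in> E"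
    using g(1) by (auto simp: valid_def R_def)
  ultimately show ?thesis unfolding fibre_def by blast
qed

lemma has_factor_glue:
  assumes IH: "\<And>E' V'. V' \<subset> V \<Longrightarrow> E' \<subseteq> E \<Longrightarrow> admissible f E' V' \<Longrightarrow> has_factor f E' V'"
    and "S \<noteq> {}"
  shows "has_factor f E V"
proof -
  let ?X = "odd_parts E (V - S)"
  obtain g where g: "\<And>C. C \<in> ?X \<Longrightarrow> \<exists>v\<in>C. g C \<in> S \<and> (v, g C) \<in> E"
    "\<And>s. s \<in> S \<Longrightarrow> int (card {C \<in> ?X. g C = s}) \<in> {f s - 1, f s}"
    using ex_assignment by blast
  from g(1) obtain n where n: "\<And>C. C \<in> ?X \<Longrightarrow> n C \<in> C \<and> g C \<in> S \<and> (n C, g C) \<in> E"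
    by metis
  have finX: "finite ?X" using fin(2) by (rule finite_odd_parts)
  have "\<exists>F\<subseteq>pendant E C (g C) (n C). sym F \<and>
      (\<forall>v\<in>insert (g C) C. int (card (F `` {v})) \<in> H_of f v)" if C: "C \<in> ?X" for C
  proof -
    have nC: "n C \<in> C" "g C \<in> S" "(n C, g C) \<in> E" using n[OF C] by auto
    \<comment> \<open>Otherwise \<open>C\<close> would be the only component assigned to
      \<open>g C\<close>, which receives at least \<open>f (g C) - 1\<close>, hence at least
      3.\<close>
    have "insert (g C) C \<noteq> V"
    proof
      assume eq: "insert (g C) C = V"
      have "{D \<in> ?X. g D = g C} \<subseteq> {C}"
      proof
        fix D assume "D \<in> {D \<in> ?X. g D = g C}"
        then have D: "D \<in> ?X" by simp
        have "D \<subseteq> C" using odd_partsD(3)[OF D] eq nC(2) by blast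
        then show "D \<in> {C}" using odd_partsD(4)[OF D] odd_parts_disjoint[OF D C] by blast
      qed
      then have "card {D \<in> ?X. g D = g C} \<le> 1"
        using card_mono[of "{C}"] by fastforce
      moreover have "f (g C) \<ge> 4" using nC(2) S adms(7) by blast
      ultimately show False using g(2)[OF nC(2)] by auto
    qed
    then have "insert (g C) C \<subset> V" using nC(2) S odd_partsD(3)[OF C] by blast
    moreover have "pendant E C (g C) (n C) \<subseteq> E"
      using nC(3) adms(2) by (auto simp: pendant_def dest: symD)
    ultimately have "has_factor f (pendant E C (g C) (n C)) (insert (g C) C)"
      by (intro IH admissible_pendant[OF C]) (use nC in auto)
    then show ?thesis unfolding has_factor_def .
  qed
  then obtain F where F: "\<And>C. C \<in> ?X \<Longrightarrow> F C \<subseteq> pendant E C (g C) (n C)"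
    "\<And>C. C \<in> ?X \<Longrightarrow> sym (F C)"
    "\<And>C v. C \<in> ?X \<Longrightarrow> v \<in> insert (g C) C \<Longrightarrow> int (card (F C `` {v})) \<in> H_of f v"
    by metis
  have "rest \<subset> V" using S \<open>S \<noteq> {}\<close> by (auto simp: rest_def)
  then have "has_factor f (E \<inter> rest \<times> rest) rest"
    by (intro IH admissible_rest) auto
  then obtain F0 where F0: "F0 \<subseteq> E \<inter> rest \<times> rest" "sym F0"
    "\<And>v. v \<in> rest \<Longrightarrow> int (card (F0 `` {v})) \<in> H_of f v"
    unfolding has_factor_def by blast
  define F1 where "F1 = F0 \<union> (\<Union>C\<in>?X. F C)"
  have pE: "pendant E C (g C) (n C) \<subseteq> E" if "C \<in> ?X" for C
    using n[OF that] adms(2) by (auto simp: pendant_def dest: symD)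
  have "F1 \<subseteq> E" using F0(1) F(1) pE unfolding F1_def by blast
  moreover have "sym F1"
    using F0(2) F(2) unfolding F1_def sym_def by blast
  moreover have "int (card (F1 `` {v})) \<in> H_of f v" if v: "v \<in> V" for v
  proof -
    consider "v \<in> rest" | C where "C \<in> ?X" "v \<in> C" | "v \<in> S"
      using v unfolding rest_def by blast
    then show ?thesis
    proof cases
      case 1
      have "F C `` {v} = {}" if "C \<in> ?X" for C
        using F(1)[OF that] n[OF that] 1 that unfolding pendant_def rest_def by blast
      then have "F1 `` {v} = F0 `` {v}" unfolding F1_def by blast
      then show ?thesis using F0(3)[OF 1] by simp
    next
      case (2 C)
      have "F0 `` {v} = {}" using F0(1) 2 unfolding rest_def by blast
      moreover have "F D `` {v} = {}" if D: "D \<in> ?X" "D \<noteq> C" for D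
      proof -
        have "v \<notin> D" using odd_parts_disjoint[OF D(1) 2(1)] 2(2) D(2) by blast
        moreover have "v \<notin> S" using 2 odd_partsD(3)[OF 2(1)] by blast
        ultimately show ?thesis using F(1)[OF D(1)] n[OF D(1)] unfolding pendant_def by blast
      qed
      ultimately have "F1 `` {v} = F C `` {v}" using 2(1) unfolding F1_def by blast
      then show ?thesis using F(3)[OF 2(1), of v] 2(2) by simp
    next
      case 3
      let ?Y = "{C \<in> ?X. g C = v}"
      have vX: "v \<notin> C" if "C \<in> ?X" for C using odd_partsD(3)[OF that] 3 by blast
      \<comment> \<open>The pendant edge is the only edge at \<open>v\<close> in this piece, and
        degrees in \<open>H_of f v\<close> are positive.\<close>
      have F_v: "F C `` {v} = {n C}" if C: "C \<in> ?Y" for C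
      proof -
        have "F C `` {v} \<subseteq> {n C}"
          using F(1)[of C] C vX unfolding pendant_def by auto
        moreover have "int (card (F C `` {v})) \<in> H_of f v" using F(3)[of C v] C by simp
        then have "F C `` {v} \<noteq> {}" using adms(7)[OF v] by (auto simp: H_of_def)
        ultimately show ?thesis by blast
      qed
      have "F C `` {v} = {}" if C: "C \<in> ?X" "g C \<noteq> v" for C
        using F(1)[OF C(1)] n[OF C(1)] vX[OF C(1)] C(2) unfolding pendant_def by blast
      moreover have "F0 `` {v} = {}" using F0(1) 3 unfolding rest_def by blast
      ultimately have "F1 `` {v} = (\<Union>C\<in>?Y. F C `` {v})" unfolding F1_def by blast
      also have "\<dots> = n ` ?Y" using F_v by blast
      \<comment> \<open>Different components attach by different vertices, so the degree of
        \<open>v\<close> is the number of components assigned to it.\<close>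
      also have "card \<dots> = card ?Y"
      proof (rule card_image, rule inj_onI)
        fix C D assume CD: "C \<in> ?Y" "D \<in> ?Y" "n C = n D"
        then show "C = D" using odd_parts_disjoint[of C E "V - S" D "n C"] n[of C] n[of D] by auto
      qed
      finally have deg: "int (card (F1 `` {v})) \<in> {f v - 1, f v}" using g(2)[OF 3] by simp
      have "odd (f v - 1)" "4 \<le> f v" using adms(6,7)[OF v] by auto
      then have "k \<in> H_of f v" if "k \<in> {f v - 1, f v}" for k
        using that unfolding H_of_def by auto
      then show ?thesis using deg by blast
    qed
  qed
  ultimately show ?thesis unfolding has_factor_def by blast
qed

end

section \<open>Existence of such a set, and the induction\<close>

lemma ex_maximal_set:
  assumes "admissible f E V"
  shows "\<exists>S. maximal_set f E V S"
proof -
  note a = admissibleD[OF assms]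
  let ?m = "Max (excess f E V ` Pow V)"
  let ?M = "{S \<in> Pow V. excess f E V S = ?m}"
  have "?m \<in> excess f E V ` Pow V" using a(1) by (intro Max_in) auto
  then obtain S0 where "S0 \<in> Pow V" "?m = excess f E V S0" by (rule imageE)
  then have "S0 \<in> ?M" by simp
  moreover have "finite ?M" using a(1) by simp
  ultimately obtain S where S: "S \<in> ?M" "\<forall>T\<in>?M. S \<subseteq> T \<longrightarrow> S = T"
    using finite_has_maximal[of ?M] by blast
  have "maximal_set f E V S"
  proof
    show "excess f E V T \<le> excess f E V S" if "T \<subseteq> V" for T
      using S(1) a(1) that by auto
    show "excess f E V T \<noteq> excess f E V S" if "T \<subseteq> V" "S \<subset> T" for T
      using S that by auto
  qed (use S assms in auto)
  then show ?thesis ..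
qed

text \<open>Gluing uses pieces with fewer vertices and no more arcs; deleting an edge keeps the
  vertices and lowers the number of arcs.\<close>

lemma has_factor_if_admissible:
  "admissible f E V \<Longrightarrow> has_factor f E V"
proof (induction "card V + card E" arbitrary: E V rule: less_induct)
  case less
  note a = admissibleD[OF less.prems]
  have finE: "finite E" using a(1,4) finite_subset by blast
  obtain S where "maximal_set f E V S" using ex_maximal_set[OF less.prems] by blast
  then interpret maximal_set f E V S .
  show ?case
  proof (cases "S = {}")
    case False
    show ?thesis
    proof (rule has_factor_glue[OF _ False])
      fix E' V' assume "V' \<subset> V" "E' \<subseteq> E" "admissible f E' V'"
      moreover from this have "card V' + card E' < card V + card E"
        by (intro add_less_le_mono psubset_card_mono a(1) card_mono finE)
      ultimately show "has_factor f E' V'"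
        using less.hyps by blast
    qed
  next
    case True
    have bound: "int (oc E (V - T)) \<le> (\<Sum>x\<in>T. f x - 1) - 2" if "T \<subseteq> V" "T \<noteq> {}" for T
    proof -
      have "S \<subset> T" using True that by blast
      then show ?thesis
        using excess_superset[of T] that oc_admissible[OF less.prems] True
        by (simp add: excess_def)
    qed
    show ?thesis
    proof (cases "\<exists>u v. (u, v) \<in> E \<and> oc (E - {(u, v), (v, u)}) V = 0")
      case True
      then obtain u v where uv: "(u, v) \<in> E" "oc (E - {(u, v), (v, u)}) V = 0" by blast
      define E' where "E' = E - {(u, v), (v, u)}"
      \<comment> \<open>For empty \<open>T\<close> this is the choice of the edge; otherwise the 2
        in \<open>bound\<close> covers the components that the deletion may create.\<close>
      have "int (oc E' (V - T)) \<le> sum f T" if T: "T \<subseteq> V" for T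
      proof (cases "T = {}")
        case True then show ?thesis using uv(2) by (simp add: E'_def)
      next
        case False
        have "(\<Sum>x\<in>T. f x - 1) \<le> sum f T" by (rule sum_mono) simp
        then show ?thesis
          using bound[OF T False] oc_delete_edge[OF a(2), of "V - T" u v] a(1)
          unfolding E'_def by simp
      qed
      then have "admissible f E' V"
        using a unfolding admissible_def E'_def by (auto simp: sym_def irrefl_def)
      moreover have "E' \<subset> E" using uv(1) by (auto simp: E'_def)
      then have "card E' < card E" using finE by (rule psubset_card_mono[rotated])
      ultimately have "has_factor f E' V" using less.hyps[of V E'] by simp
      then show ?thesis using \<open>E' \<subset> E\<close> unfolding has_factor_def by blast
    next
      case False
      show ?thesis
      proof (rule has_factor_all_edges[OF less.prems])
        show "int (oc E (V - {v})) \<le> f v - 1" if "v \<in> V" for v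
          using bound[of "{v}"] that by simp
        show "oc (E - {(u, v), (v, u)}) V \<noteq> 0" if "(u, v) \<in> E" for u v
          using False that by metis
      qed
    qed
  qed
qed

section \<open>Components of a graph with deleted vertices\<close>

text \<open>Minimality of \<open>C\<close> yields connectedness, and closure under adjacency in
  \<open>G - S\<close> yields maximality.\<close>

lemma part_in_components:
  fixes G :: "'a pair_pre_digraph"
  assumes G: "pair_graph G" and C: "C \<in> parts (parcs G) (pverts G - S)"
  shows "delete_verts (with_proj G) S \<restriction> C \<in> components (delete_verts (with_proj G) S)"
proof -
  interpret pair_graph G by (rule G)
  let ?E = "parcs G" and ?W = "pverts G - S" and ?K = "delete_verts (with_proj G) S"
  have sym: "(b, a) \<in> ?E" if "(a, b) \<in> ?E" for a b
    using that by (rule arcs_symmetric)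
  have sepC: "separated ?E ?W C" and "C \<noteq> {}" and CW: "C \<subseteq> ?W"
    and minC: "\<And>B. B \<noteq> {} \<Longrightarrow> separated ?E ?W B \<Longrightarrow> B \<subseteq> C \<Longrightarrow> B = C"
    using C by (auto simp: parts_def dest: separated_subset)
  have K: "verts ?K = ?W" "arcs ?K = {e \<in> ?E. fst e \<in> ?W \<and> snd e \<in> ?W}"
    "tail ?K = fst" "head ?K = snd"
    by (auto simp: delete_verts_def induce_subgraph_def)
  have KC: "verts (?K \<restriction> C) = C" "arcs (?K \<restriction> C) = {e \<in> ?E. fst e \<in> C \<and> snd e \<in> C}"
    "tail (?K \<restriction> C) = fst" "head (?K \<restriction> C) = snd"
    using CW by (auto simp: K induce_subgraph_def)
  have wf: "wf_digraph ?K" "wf_digraph (?K \<restriction> C)"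
    by (auto simp: wf_digraph_def K KC)
  have M: "parcs (mk_symmetric (?K \<restriction> C)) = ?E \<inter> C \<times> C"
    unfolding parcs_mk_symmetric KC by (auto intro: sym)
  have "connected (?K \<restriction> C)"
    unfolding connected_def
  proof (rule strongly_connectedI)
    show "verts (with_proj (mk_symmetric (?K \<restriction> C))) \<noteq> {}" using \<open>C \<noteq> {}\<close> KC by simp
    fix u v
    assume "u \<in> verts (with_proj (mk_symmetric (?K \<restriction> C)))"
      "v \<in> verts (with_proj (mk_symmetric (?K \<restriction> C)))"
    then have uv: "u \<in> C" "v \<in> C" using KC by auto
    \<comment> \<open>The vertices reachable from \<open>u\<close> inside \<open>C\<close> form a
      nonempty separated set, hence all of \<open>C\<close>.\<close>
    define B where "B = {b \<in> C. (u, b) \<in> rtrancl_on C (?E \<inter> C \<times> C)}"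
    have "y \<in> B" if "x \<in> B" "(x, y) \<in> ?E" "y \<in> ?W" for x y
    proof -
      have "x \<in> C" "(u, x) \<in> rtrancl_on C (?E \<inter> C \<times> C)" using that(1) by (auto simp: B_def)
      moreover have "y \<in> C" using separatedD[OF sepC \<open>x \<in> C\<close> that(2,3)] .
      ultimately show ?thesis
        using that(2) unfolding B_def by (auto intro: rtrancl_on_into_rtrancl_on)
    qed
    then have "separated ?E ?W B"
      using CW unfolding separated_def B_def by blast
    moreover have "u \<in> B" using uv by (simp add: B_def)
    ultimately have "B = C" using minC[of B] unfolding B_def by blast
    then show "u \<rightarrow>\<^sup>*\<^bsub>with_proj (mk_symmetric (?K \<restriction> C))\<^esub> v"
      using uv unfolding reachable_def B_def by (simp add: M KC) blast
  qed
  moreover have "subgraph (?K \<restriction> C) ?K"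
    unfolding subgraph_def compatible_def using CW wf by (auto simp: K KC)
  moreover have "\<not> connected y"
    if ne: "?K \<restriction> C \<noteq> y" and sub: "subgraph (?K \<restriction> C) y" "subgraph y ?K" for y
  proof
    assume "connected y"
    have Cy: "C \<subseteq> verts y" and yW: "verts y \<subseteq> ?W" and arcs_y: "arcs (?K \<restriction> C) \<subseteq> arcs y" "arcs y \<subseteq> arcs ?K"
      and wf_y: "wf_digraph y" and ty: "tail y = fst" "head y = snd"
      using sub by (auto simp: subgraph_def compatible_def K KC)
    obtain u where u: "u \<in> C" using \<open>C \<noteq> {}\<close> by blast
    have yE: "(a, b) \<in> ?E" if "(a, b) \<in> parcs (mk_symmetric y)" for a b
      using that arcs_y(2) sym unfolding parcs_mk_symmetric ty K by auto
    \<comment> \<open>A walk of \<open>y\<close> that starts in \<open>C\<close> never leaves it, so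
      a connected \<open>y\<close> has vertex set \<open>C\<close> and, lying above the induced
      subgraph, equals it.\<close>
    have reach: "w \<in> C" if "(a, w) \<in> rtrancl_on (verts y) (parcs (mk_symmetric y))" "a \<in> C" for a w
      using that
    proof (induction rule: rtrancl_on.induct)
      case (rtrancl_on_into_rtrancl_on a b c)
      then show ?case using separatedD[OF sepC] yE yW by blast
    qed
    have "w \<in> C" if w: "w \<in> verts y" for w
    proof (rule reach[OF _ u])
      show "(u, w) \<in> rtrancl_on (verts y) (parcs (mk_symmetric y))"
        using \<open>connected y\<close> w u Cy
        unfolding connected_def strongly_connected_def reachable_def by auto
    qed
    then have "verts y = C" using Cy by blast
    moreover have "arcs y = arcs (?K \<restriction> C)"
    proof
      show "arcs y \<subseteq> arcs (?K \<restriction> C)"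
        using wf_digraph.wellformed[OF wf_y] arcs_y(2) \<open>verts y = C\<close> unfolding KC K ty by blast
    qed (rule arcs_y(1))
    ultimately have "?K \<restriction> C = y" using ty KC by (intro pre_digraph.equality) auto
    with ne show False by simp
  qed
  ultimately have "pre_digraph.max_subgraph ?K connected (?K \<restriction> C)"
    by (intro pre_digraph.max_subgraphI) auto
  then show ?thesis by (simp add: components_def)
qed

text \<open>This direction carries the upper bound in the hypothesis over to
  \<open>oc\<close>.\<close>

lemma oc_le_num_odd_components:
  fixes G :: "'a pair_pre_digraph"
  assumes G: "pair_graph G"
  shows "oc (parcs G) (pverts G - S) \<le> num_odd_components (delete_verts (with_proj G) S)"
proof -
  interpret pair_graph G by (rule G)
  let ?K = "delete_verts (with_proj G) S"
  let ?mk = "\<lambda>(V, A). \<lparr>verts = V, arcs = A, tail = tail ?K, head = head ?K\<rparr>"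
  have finK: "finite (verts ?K)" "finite (arcs ?K)"
    by (auto simp: delete_verts_def induce_subgraph_def)
  \<comment> \<open>Finiteness is essential, as an infinite set has \<open>card\<close> 0. Subgraphs
    inherit tail and head, so vertex and arc sets determine them.\<close>
  have "components ?K \<subseteq> ?mk ` (Pow (verts ?K) \<times> Pow (arcs ?K))"
  proof
    fix c assume "c \<in> components ?K"
    then have "subgraph c ?K"
      by (auto simp: components_def pre_digraph.max_subgraph_def)
    then have "c = ?mk (verts c, arcs c)" "(verts c, arcs c) \<in> Pow (verts ?K) \<times> Pow (arcs ?K)"
      by (auto simp: subgraph_def compatible_def)
    then show "c \<in> ?mk ` (Pow (verts ?K) \<times> Pow (arcs ?K))" by (rule image_eqI)
  qed
  then have fin: "finite (components ?K)"
    by (rule finite_subset) (simp add: finK)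
  have "inj_on (\<lambda>C. ?K \<restriction> C) (odd_parts (parcs G) (pverts G - S))"
    by (rule inj_onI) (metis induce_subgraph_verts)
  then show ?thesis
    unfolding oc_def num_odd_components_def
    using fin part_in_components[OF G]
    by (intro card_inj_on_le[of "\<lambda>C. ?K \<restriction> C"]) (auto simp: odd_parts_def)
qed

section \<open>Transfer from edge relations to graphs\<close>

theorem theorem5:
  fixes G :: "'a pair_pre_digraph" and f :: "'a \<Rightarrow> int"
  assumes "pair_graph G"
    and "even (card (pverts G))"
    and "\<And>v. v \<in> pverts G \<Longrightarrow> f v > 0"
    and "\<And>v. v \<in> pverts G \<Longrightarrow> even (f v)"
    and "\<And>v. v \<in> pverts G \<Longrightarrow> f v \<ge> 4"
    and "\<And>S. S \<subseteq> pverts G \<Longrightarrow>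
           int (num_odd_components (delete_verts (with_proj G) S)) \<le> (\<Sum>x\<in>S. f x)"
  shows "\<exists>F. is_factor (H_of f) F G"
proof -
  interpret pair_graph G by (rule assms(1))
  have sym: "sym (parcs G)" by (rule symI) (rule arcs_symmetric)
  have "int (oc (parcs G) (pverts G - S)) \<le> sum f S" if "S \<subseteq> pverts G" for S
    using assms(6)[OF that] oc_le_num_odd_components[OF assms(1), of S] by linarith
  moreover have "irrefl (parcs G)" using no_loops' unfolding irrefl_def by blast
  ultimately have "admissible f (parcs G) (pverts G)"
    unfolding admissible_def using assms(2,4,5) sym by (auto simp: in_arcsD1 in_arcsD2)
  then have "has_factor f (parcs G) (pverts G)" by (rule has_factor_if_admissible)
  then obtain F where F: "F \<subseteq> parcs G" "sym F"
    "\<And>v. v \<in> pverts G \<Longrightarrow> int (card (F `` {v})) \<in> H_of f v"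
    unfolding has_factor_def by blast
  let ?F = "\<lparr>pverts = pverts G, parcs = F\<rparr>"
  have ends: "fst e \<in> pverts G" "snd e \<in> pverts G" "fst e \<noteq> snd e" if "e \<in> F" for e
    using that F(1) arc_fst_in_verts arc_snd_in_verts no_loops by auto
  have "finite F" using F(1) pair_finite_arcs finite_subset by blast
  then have pg: "pair_graph ?F"
    using ends F(2) pair_finite_verts by unfold_locales (auto simp: symmetric_def)
  then interpret F: pair_graph ?F .
  have "spanning (with_proj ?F) (with_proj G)"
    unfolding spanning_def subgraph_def compatible_def
    using F(1) F.wf_digraph_axioms wf_digraph_axioms by auto
  moreover have "out_degree (with_proj ?F) v = card (F `` {v})" for v
  proof -
    have "{e \<in> F. fst e = v} = Pair v ` (F `` {v})" by force
    then show ?thesis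
      unfolding out_degree_def out_arcs_def by (simp add: card_image inj_on_def)
  qed
  ultimately show ?thesis
    unfolding is_factor_def using pg F(3) by (intro exI[of _ ?F]) auto
qed

end
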